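(* Let $\to$ be an acyclic reflexive relation on a finite set $S$ and let $(\twoheadrightarrow,\hookrightarrow)=\operatorname{Fact}(\to)$. Then $\operatorname{Pairs}(\to)$ is semidistributive if and only if $\to=\operatorname{Mult}(\twoheadrightarrow,\hookrightarrow)$, in which case $(S,\to,\twoheadrightarrow,\hookrightarrow)$ is a two-acyclic factorization system.
   Context: An acyclic reflexive relation is a reflexive relation that, when interpreted as a directed graph, is acyclic except for 1-cycles. For a binary relation $\to$ on a set $S$ and $X\subseteq S$, put $X^\perp=\{y\in S: x\not\to y\ \forall x\in X\}$ and ${}^\perp X=\{y\in S: y\not\to x\ \forall x\in X\}$. A maximal orthogonal pair is a pair $(X,Y)$ of subsets of $S$ with $Y=X^\perp$ and $X={}^\perp Y$. $\operatorname{Pairs}(\to)$ is the complete lattice of maximal orthogonal pairs, partially ordered by containment of first components (equivalently reverse containment of second components). For a reflexive relation $\to$ on $S$, $\operatorname{Fact}(\to)=(\twoheadrightarrow,\hookrightarrow)$, where $x\twoheadrightarrow y$ iff for all $z$, $y\to z$ implies $x\to z$, and $x\hookrightarrow y$ iff for all $z$, $z\to x$ implies $z\to y$. For preorders $\twoheadrightarrow,\hookrightarrow$ on $S$, $\operatorname{Mult}(\twoheadrightarrow,\hookrightarrow)$ is the relation relating $x$ to $z$ iff there is $y\in S$ with $x\twoheadrightarrow y\hookrightarrow z$. A factorization system is a tuple $(S,\to,\twoheadrightarrow,\hookrightarrow)$ with $\to$ reflexive, $\operatorname{Fact}(\to)=(\twoheadrightarrow,\hookrightarrow)$ and $\operatorname{Mult}(\twoheadrightarrow,\hookrightarrow)=\to$.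 It is two-acyclic if $x\twoheadrightarrow y\twoheadrightarrow x$ implies $x=y$, $x\hookrightarrow y\hookrightarrow x$ implies $x=y$, and $x\twoheadrightarrow y\hookrightarrow x$ implies $x=y$. A lattice is semidistributive if $x\vee y=x\vee z$ implies $x\vee(y\wedge z)=x\vee y$ and $x\wedge y=x\wedge z$ implies $x\wedge(y\vee z)=x\wedge y$. *)

theory Defs
  imports "HOL-Algebra.Complete_Lattice"
begin

text \<open>Relations on a carrier \<open>S\<close> are sets of pairs, required to lie in \<open>S \<times> S\<close>. This has to be stated
  explicitly, since \<^const>\<open>refl_on\<close> does not imply it.\<close>

definition reflexive_relation :: "'a set \<Rightarrow> 'a rel \<Rightarrow> bool" where
  "reflexive_relation S R \<longleftrightarrow> R \<subseteq> S \<times> S \<and> refl_on S R"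

definition acyclic_reflexive :: "'a set \<Rightarrow> 'a rel \<Rightarrow> bool" where
  "acyclic_reflexive S R \<longleftrightarrow> reflexive_relation S R \<and> acyclic (R - Id)"

definition right_perp :: "'a set \<Rightarrow> 'a rel \<Rightarrow> 'a set \<Rightarrow> 'a set" where
  "right_perp S R X = {y \<in> S. \<forall>x\<in>X. (x, y) \<notin> R}"

definition left_perp :: "'a set \<Rightarrow> 'a rel \<Rightarrow> 'a set \<Rightarrow> 'a set" where
  "left_perp S R Y = {y \<in> S. \<forall>x\<in>Y. (y, x) \<notin> R}"

definition maximal_orthogonal_pair :: "'a set \<Rightarrow> 'a rel \<Rightarrow> 'a set \<times> 'a set \<Rightarrow> bool" where
  "maximal_orthogonal_pair S R P \<longleftrightarrow>
     fst P \<subseteq> S \<and> snd P \<subseteq> S \<and> snd P = right_perp S R (fst P) \<and> fst P = left_perp S R (snd P)"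

definition Pairs :: "'a set \<Rightarrow> 'a rel \<Rightarrow> ('a set \<times> 'a set) gorder" where
  "Pairs S R =
     \<lparr>carrier = {P. maximal_orthogonal_pair S R P}, eq = (=), le = (\<lambda>P Q. fst P \<subseteq> fst Q)\<rparr>"

text \<open>The lattice structure of \<open>Pairs S R\<close> is not part of the record; it is proved below in
  \<open>complete_lattice_Pairs\<close>, so \<open>lattice L\<close> in the next definition is not an extra condition there.\<close>

definition semidistributive :: "('a, 'b) gorder_scheme \<Rightarrow> bool" where
  "semidistributive L \<longleftrightarrow> lattice L \<and>
     (\<forall>x\<in>carrier L. \<forall>y\<in>carrier L. \<forall>z\<in>carrier L.
        (x \<squnion>\<^bsub>L\<^esub> y = x \<squnion>\<^bsub>L\<^esub> z \<longrightarrow> x \<squnion>\<^bsub>L\<^esub> (y \<sqinter>\<^bsub>L\<^esub> z) = x \<squnion>\<^bsub>L\<^esub> y) \<and>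
        (x \<sqinter>\<^bsub>L\<^esub> y = x \<sqinter>\<^bsub>L\<^esub> z \<longrightarrow> x \<sqinter>\<^bsub>L\<^esub> (y \<squnion>\<^bsub>L\<^esub> z) = x \<sqinter>\<^bsub>L\<^esub> y))"

definition Fact :: "'a set \<Rightarrow> 'a rel \<Rightarrow> 'a rel \<times> 'a rel" where
  "Fact S R =
     ({(x, y) \<in> S \<times> S. \<forall>z\<in>S. (y, z) \<in> R \<longrightarrow> (x, z) \<in> R},
      {(x, y) \<in> S \<times> S. \<forall>z\<in>S. (z, x) \<in> R \<longrightarrow> (z, y) \<in> R})"

definition Mult :: "'a set \<Rightarrow> 'a rel \<Rightarrow> 'a rel \<Rightarrow> 'a rel" where
  "Mult S E M = {(x, z) \<in> S \<times> S. \<exists>y\<in>S. (x, y) \<in> E \<and> (y, z) \<in> M}"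

definition factorization_system :: "'a set \<Rightarrow> 'a rel \<Rightarrow> 'a rel \<Rightarrow> 'a rel \<Rightarrow> bool" where
  "factorization_system S R E M \<longleftrightarrow>
     reflexive_relation S R \<and> Fact S R = (E, M) \<and> Mult S E M = R"

definition two_acyclic :: "'a set \<Rightarrow> 'a rel \<Rightarrow> 'a rel \<Rightarrow> bool" where
  "two_acyclic S E M \<longleftrightarrow>
     (\<forall>x\<in>S. \<forall>y\<in>S. ((x, y) \<in> E \<and> (y, x) \<in> E \<longrightarrow> x = y) \<and>
                 ((x, y) \<in> M \<and> (y, x) \<in> M \<longrightarrow> x = y) \<and>
                 ((x, y) \<in> E \<and> (y, x) \<in> M \<longrightarrow> x = y))"

lemma Pairs_carrierD:
  assumes "P \<in> carrier (Pairs S R)"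
  shows "fst P \<subseteq> S" "snd P \<subseteq> S"
    "snd P = right_perp S R (fst P)" "fst P = left_perp S R (snd P)"
  using assms unfolding Pairs_def maximal_orthogonal_pair_def partial_object.simps mem_Collect_eq
  by blast+

lemma Pairs_le_iff:
  assumes P: "P \<in> carrier (Pairs S R)" and Q: "Q \<in> carrier (Pairs S R)"
  shows "P \<sqsubseteq>\<^bsub>Pairs S R\<^esub> Q \<longleftrightarrow> snd Q \<subseteq> snd P"
proof
  assume "P \<sqsubseteq>\<^bsub>Pairs S R\<^esub> Q"
  then have "right_perp S R (fst Q) \<subseteq> right_perp S R (fst P)"
    by (auto simp: Pairs_def right_perp_def)
  then show "snd Q \<subseteq> snd P"
    by (metis Pairs_carrierD(3)[OF P] Pairs_carrierD(3)[OF Q])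
next
  assume "snd Q \<subseteq> snd P"
  then have "left_perp S R (snd P) \<subseteq> left_perp S R (snd Q)"
    by (auto simp: left_perp_def)
  then have "fst P \<subseteq> fst Q"
    by (metis Pairs_carrierD(4)[OF P] Pairs_carrierD(4)[OF Q])
  then show "P \<sqsubseteq>\<^bsub>Pairs S R\<^esub> Q"
    by (simp add: Pairs_def)
qed

lemma right_perp_left_perp_right_perp:
  "X \<subseteq> S \<Longrightarrow> right_perp S R (left_perp S R (right_perp S R X)) = right_perp S R X"
  by (auto simp: right_perp_def left_perp_def)

lemma left_perp_right_perp_left_perp:
  "Y \<subseteq> S \<Longrightarrow> left_perp S R (right_perp S R (left_perp S R Y)) = left_perp S R Y"
  by (auto simp: right_perp_def left_perp_def)

lemma complete_lattice_Pairs: "complete_lattice (Pairs S R)"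
proof
  let ?L = "Pairs S R"
  fix A assume A: "A \<subseteq> carrier ?L"
  define Y where "Y = {y \<in> S. \<forall>P\<in>A. y \<in> snd P}"
  define X where "X = {x \<in> S. \<forall>P\<in>A. x \<in> fst P}"
  have YS: "Y \<subseteq> S" and XS: "X \<subseteq> S" by (auto simp: X_def Y_def)
  have memR: "y \<in> snd P \<longleftrightarrow> y \<in> S \<and> (\<forall>x\<in>fst P. (x, y) \<notin> R)" if "P \<in> A" for P y
    using Pairs_carrierD(3)[of P S R] that A unfolding right_perp_def by blast
  have memL: "x \<in> fst P \<longleftrightarrow> x \<in> S \<and> (\<forall>y\<in>snd P. (x, y) \<notin> R)" if "P \<in> A" for P x
    using Pairs_carrierD(4)[of P S R] that A unfolding left_perp_def by blast
  have "Y = right_perp S R (\<Union>P\<in>A. fst P)"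
    unfolding Y_def right_perp_def using memR by blast
  moreover have "(\<Union>P\<in>A. fst P) \<subseteq> S"
    using A Pairs_carrierD(1) by blast
  ultimately have Yc: "right_perp S R (left_perp S R Y) = Y"
    by (simp add: right_perp_left_perp_right_perp)
  have "X = left_perp S R (\<Union>P\<in>A. snd P)"
    unfolding X_def left_perp_def using memL by blast
  moreover have "(\<Union>P\<in>A. snd P) \<subseteq> S"
    using A Pairs_carrierD(2) by blast
  ultimately have Xc: "left_perp S R (right_perp S R X) = X"
    by (simp add: left_perp_right_perp_left_perp)
  have sub: "left_perp S R Z \<subseteq> S" "right_perp S R Z \<subseteq> S" for Z
    by (auto simp: left_perp_def right_perp_def)
  have c1: "(left_perp S R Y, Y) \<in> carrier ?L" and c2: "(X, right_perp S R X) \<in> carrier ?L"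
    using YS XS sub by (simp_all add: Pairs_def maximal_orthogonal_pair_def Yc Xc)
  have le: "P \<sqsubseteq>\<^bsub>?L\<^esub> Q \<longleftrightarrow> fst P \<subseteq> fst Q" for P Q by (simp add: Pairs_def)
  have "least ?L (left_perp S R Y, Y) (Upper ?L A)"
  proof (rule least_UpperI)
    fix P assume P: "P \<in> A"
    then show "P \<sqsubseteq>\<^bsub>?L\<^esub> (left_perp S R Y, Y)"
      using A c1 by (subst Pairs_le_iff) (auto simp: Y_def)
  next
    fix Q assume Q: "Q \<in> Upper ?L A"
    then have Qc: "Q \<in> carrier ?L" by (simp add: Upper_def)
    have "snd Q \<subseteq> snd P" if "P \<in> A" for P
    proof -
      have Pc: "P \<in> carrier ?L"
        using A that by blast
      then have "P \<sqsubseteq>\<^bsub>?L\<^esub> Q"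
        using that Q unfolding Upper_def by blast
      then show ?thesis
        by (simp only: Pairs_le_iff[OF Pc Qc])
    qed
    then show "(left_perp S R Y, Y) \<sqsubseteq>\<^bsub>?L\<^esub> Q"
      using Pairs_carrierD(2)[OF Qc] by (subst Pairs_le_iff[OF c1 Qc]) (auto simp: Y_def)
  qed (use A c1 in auto)
  then show "\<exists>s. least ?L s (Upper ?L A)" ..
  have "greatest ?L (X, right_perp S R X) (Lower ?L A)"
  proof (rule greatest_LowerI)
    fix Q assume Q: "Q \<in> Lower ?L A"
    then have Qc: "Q \<in> carrier ?L" by (simp add: Lower_def)
    have "fst Q \<subseteq> fst P" if "P \<in> A" for P
    proof -
      have "Q \<sqsubseteq>\<^bsub>?L\<^esub> P"
        using that Q A unfolding Lower_def by blast
      then show ?thesis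
        by (simp only: le)
    qed
    then show "Q \<sqsubseteq>\<^bsub>?L\<^esub> (X, right_perp S R X)"
      using Pairs_carrierD(1)[OF Qc] by (auto simp: le X_def)
  qed (use A c2 in \<open>auto simp: le X_def\<close>)
  then show "\<exists>i. greatest ?L i (Lower ?L A)" ..
next
  fix P Q assume "P \<sqsubseteq>\<^bsub>Pairs S R\<^esub> Q" "Q \<sqsubseteq>\<^bsub>Pairs S R\<^esub> P"
    and c: "P \<in> carrier (Pairs S R)" "Q \<in> carrier (Pairs S R)"
  then have "fst P = fst Q" "snd P = snd Q"
    using Pairs_le_iff[OF c] Pairs_le_iff[OF c(2) c(1)] by (auto simp: Pairs_def)
  then show "P .=\<^bsub>Pairs S R\<^esub> Q"
    by (simp add: Pairs_def prod_eq_iff)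
qed (auto simp: Pairs_def)

end

theory Submission
  imports Defs
begin

text \<open>If \<open>R = Mult S E M\<close>, an arrow from a first component into a point \<open>w\<close> can be replaced by an
  arrow \<open>(u, w) \<in> M\<close> from a point \<open>u\<close> of that first component, since first components are closed
  under \<open>E\<close>. The points violating join semidistributivity are closed under passing from \<open>w\<close> to \<open>u\<close>,
  so a minimal one would lie in the first component and in the second component of the same meet,
  contradicting reflexivity. Meet semidistributivity is the same statement for the converse relation.

  Conversely, let \<open>(x, z) \<in> R\<close> and choose \<open>y\<close> minimal with \<open>(x, y) \<in> E\<close> and \<open>(y, z) \<in> R\<close>. The pair
  generated by \<open>y\<close> has the same meet with the pairs cogenerated by \<open>y\<close> and by \<open>z\<close>, because in both
  cases exactly \<open>y\<close> is removed. By semidistributivity \<open>y\<close> does not lie below the join of the two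
  cogenerated pairs, and acyclicity turns a witness of this into \<open>(y, z) \<in> M\<close>.\<close>

section \<open>Reflexive acyclic relations and arrow reversal\<close>

lemma acyclic_reflexiveD:
  assumes "acyclic_reflexive S R"
  shows "R \<subseteq> S \<times> S" "x \<in> S \<Longrightarrow> (x, x) \<in> R" "(x, y) \<in> R \<Longrightarrow> (y, x) \<in> R \<Longrightarrow> x = y"
proof -
  show "R \<subseteq> S \<times> S" "x \<in> S \<Longrightarrow> (x, x) \<in> R"
    using assms by (auto simp: acyclic_reflexive_def reflexive_relation_def refl_on_def)
  show "x = y" if "(x, y) \<in> R" "(y, x) \<in> R"
  proof (rule ccontr)
    assume "x \<noteq> y"
    then have "(x, x) \<in> (R - Id)\<^sup>+"
      using that by (blast intro: trancl_into_trancl)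
    then show False
      using assms by (simp add: acyclic_reflexive_def acyclic_def)
  qed
qed

lemma acyclic_reflexive_converse:
  "acyclic_reflexive S R \<Longrightarrow> acyclic_reflexive S (R\<inverse>)"
proof -
  have "R\<inverse> - Id = (R - Id)\<inverse>"
    by auto
  then show "acyclic_reflexive S R \<Longrightarrow> acyclic_reflexive S (R\<inverse>)"
    by (auto simp: acyclic_reflexive_def reflexive_relation_def refl_on_def)
qed

lemma wf_acyclic_reflexive:
  assumes "finite S" "acyclic_reflexive S R"
  shows "wf (R - Id)"
proof (rule finite_acyclic_wf)
  show "finite (R - Id)"
    using finite_subset[OF acyclic_reflexiveD(1)[OF assms(2)]] assms(1) by simp
  show "acyclic (R - Id)"
    using assms by (simp add: acyclic_reflexive_def)
qed

lemma Fact_converse: "Fact S R = (E, M) \<Longrightarrow> Fact S (R\<inverse>) = (M\<inverse>, E\<inverse>)"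
  by (auto simp: Fact_def)

lemma Mult_converse: "Mult S (M\<inverse>) (E\<inverse>) = (Mult S E M)\<inverse>"
  by (auto simp: Mult_def)

lemma perp_converse:
  "right_perp S (R\<inverse>) = left_perp S R" "left_perp S (R\<inverse>) = right_perp S R"
  by (simp_all add: fun_eq_iff right_perp_def left_perp_def)

text \<open>Reversing arrows exchanges the two perps, hence the components of a pair, so that
  statements about joins transfer to meets.\<close>

lemma swap_in_Pairs_converse:
  "P \<in> carrier (Pairs S R) \<Longrightarrow> prod.swap P \<in> carrier (Pairs S (R\<inverse>))"
  unfolding Pairs_def maximal_orthogonal_pair_def perp_converse partial_object.simps
    mem_Collect_eq fst_swap snd_swap
  by blast

lemma Fact_subset:
  assumes "reflexive_relation S R" "Fact S R = (E, M)"
  shows "E \<subseteq> R" "M \<subseteq> R"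
  using assms by (auto simp: Fact_def reflexive_relation_def refl_on_def)

text \<open>For \<open>(x, y) \<in> E\<close> and \<open>(y, z) \<in> M\<close>, the loop at
  \<open>y\<close> gives \<open>(x, y) \<in> R\<close>, which \<open>M\<close> carries to
  \<open>(x, z) \<in> R\<close>. Only the inclusion \<open>R \<subseteq> Mult S E M\<close> is then
  at stake in the equivalence.\<close>

lemma Mult_Fact_subset:
  assumes "reflexive_relation S R" "Fact S R = (E, M)"
  shows "Mult S E M \<subseteq> R"
  using assms by (auto simp: Fact_def Mult_def reflexive_relation_def refl_on_def)

section \<open>Meets and joins of orthogonal pairs\<close>

interpretation Pairs: complete_lattice "Pairs S R" for S R
  by (rule complete_lattice_Pairs)

lemma le_Pairs: "P \<sqsubseteq>\<^bsub>Pairs S R\<^esub> Q \<longleftrightarrow> fst P \<subseteq> fst Q"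
  by (simp add: Pairs_def)

lemma Pairs_eqI_fst:
  assumes "P \<in> carrier (Pairs S R)" "Q \<in> carrier (Pairs S R)" "fst P = fst Q"
  shows "P = Q"
  using assms Pairs_carrierD(3)[of P] Pairs_carrierD(3)[of Q] by (simp add: prod_eq_iff)

lemma Pairs_eqI_snd:
  assumes "P \<in> carrier (Pairs S R)" "Q \<in> carrier (Pairs S R)" "snd P = snd Q"
  shows "P = Q"
  using assms Pairs_carrierD(4)[of P] Pairs_carrierD(4)[of Q] by (simp add: prod_eq_iff)

text \<open>The perps form a Galois connection, so three perps reduce to one. The result is the
  least pair with \<open>X\<close> inside its first component.\<close>

lemma generated_in_Pairs:
  "X \<subseteq> S \<Longrightarrow> (left_perp S R (right_perp S R X), right_perp S R X) \<in> carrier (Pairs S R)"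
  by (auto simp: Pairs_def maximal_orthogonal_pair_def right_perp_def left_perp_def)

lemma cogenerated_in_Pairs:
  "Y \<subseteq> S \<Longrightarrow> (left_perp S R Y, right_perp S R (left_perp S R Y)) \<in> carrier (Pairs S R)"
  by (auto simp: Pairs_def maximal_orthogonal_pair_def right_perp_def left_perp_def)

lemma fst_meet_Pairs:
  assumes P: "P \<in> carrier (Pairs S R)" and Q: "Q \<in> carrier (Pairs S R)"
  shows "fst (P \<sqinter>\<^bsub>Pairs S R\<^esub> Q) = fst P \<inter> fst Q"
proof
  show "fst (P \<sqinter>\<^bsub>Pairs S R\<^esub> Q) \<subseteq> fst P \<inter> fst Q"
    using Pairs.meet_left[OF P Q] Pairs.meet_right[OF P Q] by (simp add: le_Pairs)
  \<comment> \<open>Since \<open>left_perp\<close> turns unions into intersections, the pair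
    cogenerated by \<open>?Y\<close> is a lower bound with the desired first component.\<close>
  let ?Y = "snd P \<union> snd Q"
  have eq: "left_perp S R ?Y = fst P \<inter> fst Q"
    using Pairs_carrierD(4)[OF P] Pairs_carrierD(4)[OF Q] by (auto simp: left_perp_def)
  have "?Y \<subseteq> S"
    using Pairs_carrierD(2) P Q by blast
  then have "(left_perp S R ?Y, right_perp S R (left_perp S R ?Y)) \<sqsubseteq>\<^bsub>Pairs S R\<^esub> P \<sqinter>\<^bsub>Pairs S R\<^esub> Q"
    using P Q by (intro Pairs.meet_le cogenerated_in_Pairs) (auto simp: le_Pairs eq)
  then show "fst P \<inter> fst Q \<subseteq> fst (P \<sqinter>\<^bsub>Pairs S R\<^esub> Q)"
    by (simp add: le_Pairs eq)
qed

lemma snd_join_Pairs: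
  assumes P: "P \<in> carrier (Pairs S R)" and Q: "Q \<in> carrier (Pairs S R)"
  shows "snd (P \<squnion>\<^bsub>Pairs S R\<^esub> Q) = snd P \<inter> snd Q"
proof
  have J: "P \<squnion>\<^bsub>Pairs S R\<^esub> Q \<in> carrier (Pairs S R)"
    using P Q by simp
  show "snd (P \<squnion>\<^bsub>Pairs S R\<^esub> Q) \<subseteq> snd P \<inter> snd Q"
    using Pairs.join_left[OF P Q] Pairs.join_right[OF P Q]
      Pairs_le_iff[OF P J] Pairs_le_iff[OF Q J] by blast
  let ?X = "fst P \<union> fst Q"
  let ?G = "(left_perp S R (right_perp S R ?X), right_perp S R ?X)"
  have eq: "right_perp S R ?X = snd P \<inter> snd Q"
    using Pairs_carrierD(3)[OF P] Pairs_carrierD(3)[OF Q] by (auto simp: right_perp_def)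
  have "?X \<subseteq> S"
    using Pairs_carrierD(1) P Q by blast
  then have G: "?G \<in> carrier (Pairs S R)"
    by (rule generated_in_Pairs)
  have "P \<squnion>\<^bsub>Pairs S R\<^esub> Q \<sqsubseteq>\<^bsub>Pairs S R\<^esub> ?G"
    using P Q G by (intro Pairs.join_le) (simp_all add: Pairs_le_iff eq)
  then show "snd P \<inter> snd Q \<subseteq> snd (P \<squnion>\<^bsub>Pairs S R\<^esub> Q)"
    unfolding Pairs_le_iff[OF J G] by (simp add: eq)
qed

lemma snd_meet_Pairs:
  assumes "P \<in> carrier (Pairs S R)" "Q \<in> carrier (Pairs S R)"
  shows "snd (P \<sqinter>\<^bsub>Pairs S R\<^esub> Q) = right_perp S R (fst P \<inter> fst Q)"
  using assms Pairs_carrierD(3)[of "P \<sqinter>\<^bsub>Pairs S R\<^esub> Q" S R] by (simp add: fst_meet_Pairs)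

lemma fst_join_Pairs:
  assumes "P \<in> carrier (Pairs S R)" "Q \<in> carrier (Pairs S R)"
  shows "fst (P \<squnion>\<^bsub>Pairs S R\<^esub> Q) = left_perp S R (snd P \<inter> snd Q)"
  using assms Pairs_carrierD(4)[of "P \<squnion>\<^bsub>Pairs S R\<^esub> Q" S R] by (simp add: snd_join_Pairs)

section \<open>From factorization to semidistributivity\<close>

lemma orthogonal_factor:
  assumes F: "Fact S R = (E, M)" and le: "R \<subseteq> Mult S E M"
    and P: "P \<in> carrier (Pairs S R)" and w: "w \<in> S" "w \<notin> snd P"
  obtains u where "u \<in> fst P" "(u, w) \<in> M"
proof -
  obtain p where p: "p \<in> fst P" "(p, w) \<in> R"
    using w Pairs_carrierD(3)[OF P] by (auto simp: right_perp_def)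
  then obtain u where u: "u \<in> S" "(p, u) \<in> E" "(u, w) \<in> M"
    using le by (auto simp: Mult_def)
  have "p \<in> left_perp S R (snd P)"
    using p(1) Pairs_carrierD(4)[OF P] by simp
  \<comment> \<open>By \<open>(p, u) \<in> E\<close>, an arrow from \<open>u\<close> into
    \<open>snd P\<close> would also be an arrow from \<open>p\<close>.\<close>
  then have "u \<in> left_perp S R (snd P)"
    using u F Pairs_carrierD(2)[OF P] by (auto simp: left_perp_def Fact_def)
  then show thesis
    using that u(3) Pairs_carrierD(4)[OF P] by simp
qed

text \<open>An arrow from \<open>X\<close> to \<open>u\<close> would extend along
  \<open>(u, w) \<in> M\<close> to an arrow from \<open>X\<close> to \<open>w\<close>.\<close>

lemma right_perp_M_closed:
  assumes "Fact S R = (E, M)" "X \<subseteq> S" "w \<in> right_perp S R X" "(u, w) \<in> M"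
  shows "u \<in> right_perp S R X"
  using assms by (auto simp: right_perp_def Fact_def)

text \<open>This is join semidistributivity read on second components: joins intersect them, and
  \<open>right_perp S R (fst Q \<inter> fst T)\<close> is the second component of the meet of
  \<open>Q\<close> and \<open>T\<close>.\<close>

lemma Pairs_join_semidistributive:
  assumes fin: "finite S" and ac: "acyclic_reflexive S R" and F: "Fact S R = (E, M)"
    and le: "R \<subseteq> Mult S E M"
    and P: "P \<in> carrier (Pairs S R)" and Q: "Q \<in> carrier (Pairs S R)"
    and T: "T \<in> carrier (Pairs S R)" and eq: "snd P \<inter> snd Q = snd P \<inter> snd T"
  shows "snd P \<inter> right_perp S R (fst Q \<inter> fst T) = snd P \<inter> snd Q"
proof -
  let ?V = "right_perp S R (fst Q \<inter> fst T)"
  let ?B = "(snd P \<inter> ?V) - snd Q"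
  have MR: "M \<subseteq> R"
    using Fact_subset(2)[OF _ F] ac by (simp add: acyclic_reflexive_def)
  have XS: "fst Q \<inter> fst T \<subseteq> S"
    using Pairs_carrierD(1) Q by blast
  have "?B = {}"
  proof (rule ccontr)
    assume "?B \<noteq> {}"
    then obtain w where w: "w \<in> ?B" and min: "\<And>u. (u, w) \<in> R - Id \<Longrightarrow> u \<notin> ?B"
      using wfE_min'[OF wf_acyclic_reflexive[OF fin ac]] by metis
    have wS: "w \<in> S"
      using w by (simp add: right_perp_def)
    \<comment> \<open>The argument needs only that \<open>N\<close> and \<open>Q\<close> have the
      same join with \<open>P\<close>, so it serves for both \<open>Q\<close> and
      \<open>T\<close>.\<close>
    have step: "w \<in> fst N" if N: "N \<in> carrier (Pairs S R)"
      and eqN: "snd P \<inter> snd N = snd P \<inter> snd Q" for N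
    proof -
      have "w \<notin> snd N"
        using w eqN by blast
      then obtain u where u: "u \<in> fst N" "(u, w) \<in> M"
        using orthogonal_factor[OF F le N wS] by blast
      have "u \<notin> snd N"
        using u(1) Pairs_carrierD(1,3)[OF N] acyclic_reflexiveD(2)[OF ac]
        unfolding right_perp_def by blast
      moreover have "u \<in> snd P"
        using right_perp_M_closed[OF F Pairs_carrierD(1)[OF P] _ u(2)] w
          Pairs_carrierD(3)[OF P] by simp
      moreover have "u \<in> ?V"
        using right_perp_M_closed[OF F XS _ u(2)] w by blast
      ultimately have "u \<in> ?B"
        using eqN by blast
      then have "u = w"
        using min u(2) MR by blast
      then show ?thesis
        using u(1) by simp
    qed
    have "w \<in> fst Q \<inter> fst T"
      using step[OF Q refl] step[OF T eq[symmetric]] by blast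
    then show False
      using w wS acyclic_reflexiveD(2)[OF ac] by (auto simp: right_perp_def)
  qed
  moreover have "snd Q \<subseteq> ?V"
    using Pairs_carrierD(3)[OF Q] by (auto simp: right_perp_def)
  ultimately show ?thesis
    by blast
qed

lemma Pairs_meet_semidistributive:
  assumes fin: "finite S" and ac: "acyclic_reflexive S R" and F: "Fact S R = (E, M)"
    and le: "R \<subseteq> Mult S E M"
    and P: "P \<in> carrier (Pairs S R)" and Q: "Q \<in> carrier (Pairs S R)"
    and T: "T \<in> carrier (Pairs S R)" and eq: "fst P \<inter> fst Q = fst P \<inter> fst T"
  shows "fst P \<inter> left_perp S R (snd Q \<inter> snd T) = fst P \<inter> fst Q"
proof -
  have "R\<inverse> \<subseteq> Mult S (M\<inverse>) (E\<inverse>)"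
    using le by (auto simp: Mult_converse)
  then have "fst P \<inter> right_perp S (R\<inverse>) (snd Q \<inter> snd T) = fst P \<inter> fst Q"
    using Pairs_join_semidistributive[OF fin acyclic_reflexive_converse[OF ac] Fact_converse[OF F] _
        P[THEN swap_in_Pairs_converse] Q[THEN swap_in_Pairs_converse] T[THEN swap_in_Pairs_converse]]
      eq by simp
  then show ?thesis
    by (simp add: perp_converse)
qed

lemma semidistributive_Pairs:
  assumes fin: "finite S" and ac: "acyclic_reflexive S R" and F: "Fact S R = (E, M)"
    and le: "R \<subseteq> Mult S E M"
  shows "semidistributive (Pairs S R)"
  unfolding semidistributive_def
proof (intro conjI ballI impI)
  show "lattice (Pairs S R)" ..
next
  fix P Q T
  assume c: "P \<in> carrier (Pairs S R)" "Q \<in> carrier (Pairs S R)" "T \<in> carrier (Pairs S R)"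
  { assume "P \<squnion>\<^bsub>Pairs S R\<^esub> Q = P \<squnion>\<^bsub>Pairs S R\<^esub> T"
    then have "snd P \<inter> snd Q = snd P \<inter> snd T"
      using c by (metis snd_join_Pairs)
    from Pairs_join_semidistributive[OF fin ac F le c this]
    show "P \<squnion>\<^bsub>Pairs S R\<^esub> (Q \<sqinter>\<^bsub>Pairs S R\<^esub> T) = P \<squnion>\<^bsub>Pairs S R\<^esub> Q"
      using c by (intro Pairs_eqI_snd[of _ S R]) (simp_all add: snd_join_Pairs snd_meet_Pairs) }
  { assume "P \<sqinter>\<^bsub>Pairs S R\<^esub> Q = P \<sqinter>\<^bsub>Pairs S R\<^esub> T"
    then have "fst P \<inter> fst Q = fst P \<inter> fst T"
      using c by (metis fst_meet_Pairs)
    from Pairs_meet_semidistributive[OF fin ac F le c this]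
    show "P \<sqinter>\<^bsub>Pairs S R\<^esub> (Q \<squnion>\<^bsub>Pairs S R\<^esub> T) = P \<sqinter>\<^bsub>Pairs S R\<^esub> Q"
      using c by (intro Pairs_eqI_fst[of _ S R]) (simp_all add: fst_join_Pairs fst_meet_Pairs) }
qed

section \<open>From semidistributivity to factorization\<close>

lemma semidistributive_Pairs_subset_Mult:
  assumes fin: "finite S" and ac: "acyclic_reflexive S R" and F: "Fact S R = (E, M)"
    and sd: "semidistributive (Pairs S R)"
  shows "R \<subseteq> Mult S E M"
proof (rule subrelI)
  fix x z assume xz: "(x, z) \<in> R"
  note acD = acyclic_reflexiveD[OF ac]
  have S: "x \<in> S" "z \<in> S"
    using xz acD(1) by auto
  have E: "(a, b) \<in> E \<longleftrightarrow> a \<in> S \<and> b \<in> S \<and> (\<forall>c\<in>S. (b, c) \<in> R \<longrightarrow> (a, c) \<in> R)" for a b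
    using F by (auto simp: Fact_def)
  have M: "(a, b) \<in> M \<longleftrightarrow> a \<in> S \<and> b \<in> S \<and> (\<forall>c\<in>S. (c, a) \<in> R \<longrightarrow> (c, b) \<in> R)" for a b
    using F by (auto simp: Fact_def)
  have ER: "E \<subseteq> R"
    using Fact_subset[OF _ F] ac by (simp_all add: acyclic_reflexive_def)
  let ?B = "{y. (x, y) \<in> E \<and> (y, z) \<in> R}"
  have "x \<in> ?B"
    using xz S E by blast
  \<comment> \<open>The chosen \<open>y\<close> must have no arrow to another point of
    \<open>?B\<close>, so minimality is taken along reversed arrows.\<close>
  moreover have "wf ((R - Id)\<inverse>)"
  proof -
    have "(R - Id)\<inverse> = R\<inverse> - Id"
      by auto
    then show ?thesis
      using wf_acyclic_reflexive[OF fin acyclic_reflexive_converse[OF ac]] by simp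
  qed
  ultimately obtain y where y: "(x, y) \<in> E" "(y, z) \<in> R"
    and min: "\<And>u. (y, u) \<in> R - Id \<Longrightarrow> u \<notin> ?B"
    by (elim wfE_min[where Q = ?B]) auto
  have yS: "y \<in> S"
    using y E by blast
  let ?J = "(left_perp S R (right_perp S R {y}), right_perp S R {y})"
  let ?N = "\<lambda>v. (left_perp S R {v}, right_perp S R (left_perp S R {v}))"
  have c: "?J \<in> carrier (Pairs S R)" "?N y \<in> carrier (Pairs S R)" "?N z \<in> carrier (Pairs S R)"
    using yS S by (simp_all add: generated_in_Pairs cogenerated_in_Pairs)
  have J: "fst ?J = {u. (y, u) \<in> E}"
    using yS by (auto simp: left_perp_def right_perp_def E)
  \<comment> \<open>A point \<open>u\<close> with \<open>(y, u) \<in> E\<close> and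
    \<open>(u, y) \<in> R\<close> equals \<open>y\<close> by antisymmetry.\<close>
  have "fst ?J \<inter> fst (?N y) = {u. (y, u) \<in> E} - {y}"
    unfolding J using acD(2,3) ER yS by (auto simp: left_perp_def E)
  moreover have "fst ?J \<inter> fst (?N z) = {u. (y, u) \<in> E} - {y}"
  proof -
    have "(u, z) \<notin> R" if "(y, u) \<in> E" "u \<noteq> y" for u
    proof -
      \<comment> \<open>Transitivity of \<open>E\<close> would put \<open>u\<close> into
        \<open>?B\<close> if also \<open>(u, z) \<in> R\<close>, against the choice of
        \<open>y\<close>.\<close>
      have "(x, u) \<in> E"
        using that(1) y(1) by (simp add: E)
      moreover have "(y, u) \<in> R - Id"
        using that ER by blast
      ultimately show ?thesis
        using min by blast
    qed
    then show ?thesis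
      unfolding J using y(2) by (auto simp: left_perp_def E)
  qed
  ultimately have eq: "fst ?J \<inter> fst (?N y) = fst ?J \<inter> fst (?N z)"
    by simp
  have "?J \<sqinter>\<^bsub>Pairs S R\<^esub> ?N y = ?J \<sqinter>\<^bsub>Pairs S R\<^esub> ?N z"
    using c eq by (intro Pairs_eqI_fst[of _ S R]) (simp_all add: fst_meet_Pairs)
  then have "?J \<sqinter>\<^bsub>Pairs S R\<^esub> (?N y \<squnion>\<^bsub>Pairs S R\<^esub> ?N z) = ?J \<sqinter>\<^bsub>Pairs S R\<^esub> ?N y"
    using sd c unfolding semidistributive_def by blast
  then have "fst ?J \<inter> left_perp S R (snd (?N y) \<inter> snd (?N z)) = fst ?J \<inter> fst (?N y)"
    using c by (metis fst_meet_Pairs fst_join_Pairs Pairs.join_closed)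
  moreover have "y \<in> fst ?J" "y \<notin> fst (?N y)"
    using yS acD(2) unfolding J by (auto simp: E left_perp_def)
  ultimately have "y \<notin> left_perp S R (snd (?N y) \<inter> snd (?N z))"
    by blast
  then obtain w where w: "(y, w) \<in> R" "w \<in> snd (?N y)" "w \<in> snd (?N z)"
    using yS by (auto simp: left_perp_def)
  \<comment> \<open>Contraposing the double perp of \<open>v\<close> yields exactly the condition
    defining \<open>M\<close>. The witness \<open>w\<close> therefore has \<open>M\<close>-arrows to
    both \<open>y\<close> and \<open>z\<close>; the first, together with
    \<open>(y, w) \<in> R\<close>, forces \<open>w = y\<close>.\<close>
  have N: "snd (?N v) = {u. (u, v) \<in> M}" if "v \<in> S" for v
    using that by (auto simp: left_perp_def right_perp_def M)
  have "(w, y) \<in> M" "(w, z) \<in> M"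
    using w N yS S by blast+
  moreover from this have "w = y"
    using w(1) acD(2,3) by (auto simp: M)
  ultimately show "(x, z) \<in> Mult S E M"
    using y S yS by (auto simp: Mult_def)
qed

section \<open>Two-acyclicity and the equivalence\<close>

lemma two_acyclic_Fact:
  assumes ac: "acyclic_reflexive S R" and F: "Fact S R = (E, M)"
  shows "two_acyclic S E M"
proof -
  have "E \<subseteq> R" "M \<subseteq> R"
    using Fact_subset[OF _ F] ac by (simp_all add: acyclic_reflexive_def)
  \<comment> \<open>Every 2-cycle in question lies in \<open>R\<close>, where antisymmetry collapses
    it.\<close>
  then show ?thesis
    unfolding two_acyclic_def using acyclic_reflexiveD(3)[OF ac] by blast
qed

theorem proposition7p13:
  fixes S :: "'a set" and R E M :: "'a rel"
  assumes "finite S"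
    and "acyclic_reflexive S R"
    and "Fact S R = (E, M)"
  shows "(semidistributive (Pairs S R) \<longleftrightarrow> R = Mult S E M) \<and>
    (semidistributive (Pairs S R) \<and> R = Mult S E M \<longrightarrow>
      factorization_system S R E M \<and> two_acyclic S E M)"
proof -
  have refl: "reflexive_relation S R"
    using assms(2) by (simp add: acyclic_reflexive_def)
  have "semidistributive (Pairs S R) \<longleftrightarrow> R = Mult S E M"
    using semidistributive_Pairs[OF assms] semidistributive_Pairs_subset_Mult[OF assms]
      Mult_Fact_subset[OF refl assms(3)] by blast
  then show ?thesis
    using refl assms two_acyclic_Fact by (auto simp: factorization_system_def)
qed

end
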